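(* Assume the Hardy–Littlewood prime $k$-tuple conjecture for pairs of linear forms. Then there exist infinitely many primes $p$ such that $14$ flanks $2p$ at distance $1$ at every occurrence; that is, there is at least one $k\ge 0$ with $2p\in S_k$, and for every $k$ with $2p\in S_k$ we have $k\ge 1$, $14\in S_{k-1}$ and $14\in S_{k+1}$.
   Context: For integers $k\ge 0$ and $n\ge 1$, $\sigma_k(n)=\sum_{d\mid n} d^k$ and $\phi(n)$ is Euler's totient function. For each $k\geq 0$, $S_k$ denotes the set of composite positive integers $n$ satisfying $n\cdot\sigma_k(n)\equiv 2 \pmod{\phi(n)}$. The Hardy–Littlewood prime $k$-tuple conjecture for pairs of linear forms asserts: if $f_1(n)=a_1n+b_1$ and $f_2(n)=a_2n+b_2$ are linear forms with integer coefficients, $a_i>0$, forming an admissible pair (i.e., for every prime $q$ there is an integer $n$ with $q\nmid f_1(n)f_2(n)$, and each $f_i$ has $\gcd(a_i,b_i)=1$), then there are infinitely many integers $n$ for which $f_1(n)$ and $f_2(n)$ are both prime. *)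

theory Defs
  imports "HOL-Number_Theory.Number_Theory"
begin

definition divisor_sigma :: "nat \<Rightarrow> nat \<Rightarrow> nat" where
  "divisor_sigma k n = (\<Sum>d | d dvd n. d ^ k)"

definition composite :: "nat \<Rightarrow> bool" where
  "composite n \<longleftrightarrow> n > 1 \<and> \<not> prime n"

definition S :: "nat \<Rightarrow> nat set" where
  "S k = {n. composite n \<and> [n * divisor_sigma k n = 2] (mod totient n)}"

definition admissible_pair :: "int \<Rightarrow> int \<Rightarrow> int \<Rightarrow> int \<Rightarrow> bool" where
  "admissible_pair a1 b1 a2 b2 \<longleftrightarrow>
     gcd a1 b1 = 1 \<and> gcd a2 b2 = 1 \<and>
     (\<forall>q::int. prime q \<longrightarrow> (\<exists>n::int. \<not> q dvd (a1 * n + b1) * (a2 * n + b2)))"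

text \<open>
  On \<^typ>\<open>int\<close>, \<^const>\<open>prime\<close> holds only of positive numbers, so both values below are
  primes in the usual sense.
\<close>

definition hardy_littlewood_pairs :: bool where
  "hardy_littlewood_pairs \<longleftrightarrow>
     (\<forall>a1 b1 a2 b2 :: int. a1 > 0 \<longrightarrow> a2 > 0 \<longrightarrow> admissible_pair a1 b1 a2 b2 \<longrightarrow>
        infinite {n::int. prime (a1 * n + b1) \<and> prime (a2 * n + b2)})"

end

theory Submission
  imports Defs
begin

text \<open>
  For a prime of the form \<open>p = 2q + 1\<close> one has \<open>2p \<in> S\<^sub>k\<close> iff \<open>q\<close> divides \<open>2\<^bsup>k+1\<^esup> + 1\<close>. With \<open>q = 3\<close>
  this says that \<open>14 \<in> S\<^sub>k\<close> iff \<open>k\<close> is even. If \<open>q \<equiv> 5 (mod 8)\<close> is prime, then \<open>2\<close> is a quadratic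
  non-residue modulo \<open>q\<close>, so \<open>2\<^bsup>h\<^esup> \<equiv> -1\<close> for the even number \<open>h = (q - 1)/2\<close>; an odd exponent \<open>j\<close>
  with \<open>2\<^bsup>j\<^esup> \<equiv> -1\<close> would give \<open>1 \<equiv> 2\<^bsup>jh\<^esup> \<equiv> -1\<close>. Hence \<open>2p\<close> lies in some \<open>S\<^sub>k\<close>, and only for odd \<open>k\<close>.
  The conjecture, applied to \<open>8n + 5\<close> and \<open>16n + 11\<close>, provides infinitely many such \<open>p\<close>.
\<close>

lemma divisors_twice_prime:
  fixes p :: nat
  assumes "prime p"
  shows "{d. d dvd 2 * p} = {1, 2, p, 2 * p}"
proof -
  have "d \<in> {1, 2, p, 2 * p}" if d: "d dvd 2 * p" for d
  proof -
    obtain a b where "d = a * b" "a dvd 2" "b dvd p"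
      using division_decomp[OF d] by blast
    moreover have "a = 1 \<or> a = 2"
      using \<open>a dvd 2\<close> two_is_prime_nat by (auto simp: prime_nat_iff)
    moreover have "b = 1 \<or> b = p"
      using \<open>b dvd p\<close> assms by (auto simp: prime_nat_iff)
    ultimately show ?thesis by auto
  qed
  then show ?thesis by auto
qed

lemma divisor_sigma_twice_prime:
  assumes "prime p" "odd p"
  shows "divisor_sigma k (2 * p) = (1 + 2 ^ k) * (1 + p ^ k)"
proof -
  \<comment> \<open>This makes 1, 2, \<open>p\<close> and \<open>2 * p\<close> pairwise distinct, so
    the sum over the set has four terms.\<close>
  have "p \<noteq> 1" "p \<noteq> 0" "p \<noteq> 2"
    using assms by auto
  then show ?thesis
    unfolding divisor_sigma_def divisors_twice_prime[OF assms(1)]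
    by (simp add: algebra_simps)
qed

text \<open>Since \<open>totient (2 * p) = 2 * q\<close> and \<open>p\<close> is 1 modulo
  \<open>2 * q\<close>, the product reduces to \<open>4 * (1 + 2 ^ k)\<close>, that is,
  \<open>2 * (2 ^ (k + 1) + 1) + 2\<close>. Subtracting 2 and cancelling the common factor 2 leaves
  the divisibility.\<close>

lemma twice_prime_mem_S_iff:
  fixes p q :: nat
  assumes "prime p" "p = 2 * q + 1"
  shows "2 * p \<in> S k \<longleftrightarrow> q dvd 2 ^ (k + 1) + 1"
proof -
  have "odd p" "p > 1"
    using assms prime_gt_1_nat[of p] by auto
  have "totient (2 * p) = p - 1"
    using \<open>odd p\<close> by (simp add: totient_double totient_prime[OF assms(1)])
  also have "p - 1 = 2 * q"
    using assms(2) by simp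
  finally have totient: "totient (2 * p) = 2 * q" .
  have "\<not> prime (2 * p)"
    using \<open>p > 1\<close> prime_product[of 2 p] by linarith
  then have "composite (2 * p)"
    using \<open>p > 1\<close> by (simp add: composite_def)
  with totient have "2 * p \<in> S k \<longleftrightarrow> [2 * p * ((1 + 2 ^ k) * (1 + p ^ k)) = 2] (mod 2 * q)"
    using divisor_sigma_twice_prime[OF assms(1) \<open>odd p\<close>] by (simp add: S_def)
  also have "\<dots> \<longleftrightarrow> [2 * (2 ^ (k + 1) + 1) + 2 = 0 + 2] (mod 2 * q)"
  proof -
    have "[p = 1] (mod 2 * q)"
      unfolding assms(2) by (simp only: cong_add_rcancel_0_nat cong_0_iff dvd_refl)
    then have "[2 * p * ((1 + 2 ^ k) * (1 + p ^ k)) = 2 * 1 * ((1 + 2 ^ k) * (1 + 1 ^ k))] (mod 2 * q)"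
      by (intro cong_mult cong_add cong_pow cong_refl)
    moreover have "2 * 1 * ((1 + 2 ^ k) * (1 + 1 ^ k)) = 2 * (2 ^ (k + 1) + 1) + (2 :: nat)"
      by simp
    ultimately show ?thesis
      by (simp only: cong_def add_0)
  qed
  also have "\<dots> \<longleftrightarrow> 2 * q dvd 2 * (2 ^ (k + 1) + 1)"
    by (simp only: cong_add_rcancel_nat cong_0_iff)
  also have "\<dots> \<longleftrightarrow> q dvd 2 ^ (k + 1) + 1"
    by (subst dvd_times_left_cancel_iff) simp_all
  finally show ?thesis .
qed

lemma fourteen_mem_S_of_even:
  assumes "even k"
  shows "14 \<in> S k"
proof -
  have "[2 ^ (k + 1) + 1 = (0 :: int)] (mod 3)"
  proof -
    \<comment> \<open>Modulo 3, the base 2 is -1, and the exponent \<open>k + 1\<close> is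
      odd.\<close>
    have "[2 ^ (k + 1) + 1 = (-1) ^ (k + 1) + (1 :: int)] (mod 3)"
      by (intro cong_add cong_pow cong_refl) (simp add: cong_def)
    then show ?thesis
      using assms by simp
  qed
  then have "int 3 dvd int (2 ^ (k + 1) + 1)"
    by (simp add: cong_0_iff add.commute)
  then have "3 dvd 2 ^ (k + 1) + (1 :: nat)"
    by (simp only: int_dvd_int_iff)
  moreover have "2 * 7 \<in> S k \<longleftrightarrow> 3 dvd 2 ^ (k + 1) + (1 :: nat)"
    by (rule twice_prime_mem_S_iff) simp_all
  moreover have "2 * 7 = (14 :: nat)"
    by simp
  ultimately show ?thesis
    by metis
qed

text \<open>Gauss's lemma applies because exactly \<open>2m + 1\<close> of the numbers
  \<open>2, 4, \<dots>, 8m + 4\<close> exceed \<open>(q - 1)/2 = 4m + 2\<close>.\<close>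

lemma two_power_half_cong_minus_one:
  fixes q m :: nat
  assumes "prime q" "q = 8 * m + 5"
  shows "[2 ^ (4 * m + 2) = -1] (mod int q)"
proof -
  interpret GAUSS q 2
    using assms by unfold_locales (auto simp: cong_def)
  have half: "(int q - 1) div 2 = 4 * int m + 2"
    using assms(2) by simp
  \<comment> \<open>Elements of \<open>A\<close> are at most \<open>4 * m + 2\<close>, so their
    doubles stay below \<open>q\<close> and need no reduction.\<close>
  have "C = (\<lambda>x. 2 * x) ` A"
    unfolding C_def B_def image_image
  proof (rule image_cong)
    fix x assume "x \<in> A"
    then show "x * 2 mod int q = 2 * x"
      using assms(2) unfolding A_def half by simp
  qed simp
  then have "E = (\<lambda>x. 2 * x) ` {2 * int m + 2..4 * int m + 2}"
    unfolding E_def A_def half by auto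
  then have "card E = card {2 * int m + 2..4 * int m + 2}"
    by (simp add: card_image inj_on_def)
  then have "card E = 2 * m + 1"
    by simp
  moreover have "nat ((int q - 1) div 2) = 4 * m + 2"
    using half by simp
  ultimately show ?thesis
    using pre_gauss_lemma by simp
qed

lemma even_exponent_of_dvd_two_power_plus_one:
  fixes q m :: nat
  assumes "prime q" "q = 8 * m + 5" "q dvd 2 ^ j + 1"
  shows "even j"
proof (rule ccontr)
  assume "odd j"
  have "int q dvd int (2 ^ j + 1)"
    using assms(3) by (simp only: int_dvd_int_iff)
  then have "[2 ^ j = -1] (mod int q)"
    by (simp add: cong_iff_dvd_diff add.commute)
  then have "[(2 ^ j) ^ (4 * m + 2) = (-1) ^ (4 * m + 2)] (mod int q)"
    by (rule cong_pow)
  moreover have "[(2 ^ (4 * m + 2)) ^ j = (-1) ^ j] (mod int q)"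
    using two_power_half_cong_minus_one[OF assms(1,2)] by (rule cong_pow)
  moreover have "(2 ^ j) ^ (4 * m + 2) = ((2 :: int) ^ (4 * m + 2)) ^ j"
    by (simp only: power_mult[symmetric] mult.commute)
  ultimately have "[1 = -1] (mod int q)"
    using \<open>odd j\<close> by (simp add: cong_def)
  then have "int q dvd 2"
    by (simp add: cong_iff_dvd_diff)
  then show False
    using zdvd_imp_le[of "int q" 2] assms(2) by simp
qed

lemma flanked_by_fourteen:
  fixes p q m :: nat
  assumes "prime p" "p = 2 * q + 1" "prime q" "q = 8 * m + 5"
  shows "(\<exists>k. 2 * p \<in> S k) \<and>
         (\<forall>k. 2 * p \<in> S k \<longrightarrow> k \<ge> 1 \<and> 14 \<in> S (k - 1) \<and> 14 \<in> S (k + 1))"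
proof (intro conjI allI impI)
  \<comment> \<open>The exponent is \<open>(q - 1) div 2\<close>, split as \<open>k + 1\<close> with
    witness \<open>k = 4 * m + 1\<close>.\<close>
  have "int q dvd int (2 ^ (4 * m + 1 + 1) + 1)"
    using two_power_half_cong_minus_one[OF assms(3,4)] by (simp add: cong_iff_dvd_diff add.commute)
  then have "q dvd 2 ^ (4 * m + 1 + 1) + 1"
    by (simp only: int_dvd_int_iff)
  then have "2 * p \<in> S (4 * m + 1)"
    using twice_prime_mem_S_iff[OF assms(1,2)] by blast
  then show "\<exists>k. 2 * p \<in> S k" ..
next
  fix k assume "2 * p \<in> S k"
  then have "q dvd 2 ^ (k + 1) + 1"
    using twice_prime_mem_S_iff[OF assms(1,2)] by blast
  then have "odd k"
    using even_exponent_of_dvd_two_power_plus_one[OF assms(3,4), of "k + 1"] by simp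
  then show "k \<ge> 1" "14 \<in> S (k - 1)" "14 \<in> S (k + 1)"
    by (auto intro!: fourteen_mem_S_of_even simp: odd_pos Suc_leI)
qed

lemma admissible_pair_8_5_16_11: "admissible_pair 8 5 16 11"
proof -
  have "\<exists>n. \<not> r dvd (8 * n + 5) * (16 * n + 11)" if "prime r" for r :: int
  proof (rule ccontr)
    assume "\<not> ?thesis"
    \<comment> \<open>The values at 0 and 1 are 5 * 11 = 55 and 13 * 27 = 351, which are
      coprime.\<close>
    then have "r dvd (8 * 0 + 5) * (16 * 0 + 11)" "r dvd (8 * 1 + 5) * (16 * 1 + 11)"
      by blast+
    then have "r dvd gcd 55 351"
      by simp
    moreover have "gcd 55 351 = (1 :: int)"
      by (simp add: gcd_non_0_int)
    ultimately show False
      using that not_prime_unit by auto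
  qed
  then show ?thesis
    by (simp add: admissible_pair_def gcd_non_0_int)
qed

theorem theorem5p1:
  assumes "hardy_littlewood_pairs"
  shows "infinite {p::nat. prime p \<and> (\<exists>k. 2 * p \<in> S k) \<and>
           (\<forall>k. 2 * p \<in> S k \<longrightarrow> k \<ge> 1 \<and> 14 \<in> S (k - 1) \<and> 14 \<in> S (k + 1))}"
    (is "infinite ?P")
proof -
  define N where "N = {n :: int. prime (8 * n + 5) \<and> prime (16 * n + 11)}"
  have "infinite N"
    using assms admissible_pair_8_5_16_11 by (simp add: N_def hardy_littlewood_pairs_def)
  \<comment> \<open>A prime \<open>8 * n + 5\<close> exceeds 1, which excludes negative
    \<open>n\<close>; hence \<open>nat\<close> truncates nothing below and stays injective.\<close>
  have nonneg: "n \<ge> 0" if "n \<in> N" for n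
    using that prime_gt_1_int[of "8 * n + 5"] by (simp add: N_def)
  have "inj_on (\<lambda>n. nat (16 * n + 11)) N"
    using nonneg by (force simp: inj_on_def)
  then have "infinite ((\<lambda>n. nat (16 * n + 11)) ` N)"
    using \<open>infinite N\<close> finite_imageD by blast
  moreover have "(\<lambda>n. nat (16 * n + 11)) ` N \<subseteq> ?P"
  proof (rule image_subsetI)
    fix n assume "n \<in> N"
    then have "prime (nat (8 * n + 5))" and p: "prime (nat (16 * n + 11))"
      by (simp_all add: N_def)
    moreover have "nat (16 * n + 11) = 2 * nat (8 * n + 5) + 1" "nat (8 * n + 5) = 8 * nat n + 5"
      using nonneg[OF \<open>n \<in> N\<close>] by simp_all
    ultimately show "nat (16 * n + 11) \<in> ?P"
      using flanked_by_fourteen[OF p] by blast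
  qed
  ultimately show ?thesis
    using infinite_super by blast
qed

end
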